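(* The intersection of all the sets $\lambda^n\widehat W$ is the set of points whose orbit under $\hat f$ stays in $\widehat W$: $$\bigcap_{n\in\mathbb N}\lambda^n\widehat W=\widehat K=\{z\in\widehat W : \hat f^n(z)\in\widehat W \text{ for all } n\in\mathbb N\}.$$
   Context: Let $\ell\geq 2$ be an even integer. Let $f$ be the real analytic function which near $0$ coincides with the real fixed point of period-doubling renormalization with critical point of degree $\ell$. With $\lambda=-f(f(0))\in(0,1)$, it satisfies the Cvitanović–Feigenbaum equation: $f(z)=-\frac1\lambda f(f(\lambda z))$ near $0$; $f(0)=1$; and $f(z)=F(z^\ell)$, where $F^{-1}$ is defined and univalent on $\mathbb C_\lambda=\mathbb C\setminus(]-\infty,-1/\lambda]\cup[1/\lambda^2,+\infty[)$. An analytic extension of $f$ is a holomorphic function on a connected open subset of $\mathbb C$ which agrees with $f$ on some nonempty open set. It is known that $f$ has a unique maximal analytic extension $\hat f:\widehat W\to\mathbb C$, i.e. one of which all analytic extensions are restrictions, and that $\widehat W$ is a simply connected open subset of $\mathbb C$. Notation: $\lambda^n\widehat W=\{\lambda^n z: z\in\widehat W\}$. In the definition of $\widehat K$, the condition means that all iterates $\hat f^n(z)$ are successively defined and lie in $\widehat W$. *)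

theory Defs
  imports "HOL-Complex_Analysis.Complex_Analysis"
begin

definition unimodal :: "(real \<Rightarrow> real) \<Rightarrow> bool" where
  "unimodal g \<longleftrightarrow>
     g ` {-1..1} \<subseteq> {-1..1} \<and> g 0 = 1 \<and>
     (\<forall>x\<in>{-1..1}. x \<noteq> 0 \<longrightarrow> x * deriv g x < 0)"

text \<open>
  With \<open>a = - g 1\<close>, the maps \<open>g\<close> to which period-doubling renormalization applies are
  those for which \<open>g\<close> exchanges the disjoint intervals \<open>[-a, a]\<close> and \<open>[g a, 1]\<close>
  (each is mapped into the other).  The renormalization of \<open>g\<close> is then the rescaling of
  \<open>g \<circ> g\<close> on \<open>[-a, a]\<close> to \<open>[-1, 1]\<close>, with the sign chosen so that \<open>0\<close> is mapped to \<open>1\<close>.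
\<close>

definition pd_renormalizable :: "(real \<Rightarrow> real) \<Rightarrow> bool" where
  "pd_renormalizable g \<longleftrightarrow>
     unimodal g \<and> 0 < - g 1 \<and> - g 1 < g (- g 1) \<and> g (g (- g 1)) \<le> - g 1"

definition pd_renormalization :: "(real \<Rightarrow> real) \<Rightarrow> real \<Rightarrow> real" where
  "pd_renormalization g x = - (1 / (- g 1)) * g (g ((- g 1) * x))"

definition pd_fixed_point :: "(real \<Rightarrow> real) \<Rightarrow> bool" where
  "pd_fixed_point g \<longleftrightarrow>
     pd_renormalizable g \<and> (\<forall>x\<in>{-1..1}. pd_renormalization g x = g x)"

definition slit_plane :: "real \<Rightarrow> complex set" where
  "slit_plane lam = UNIV - of_real ` ({..- 1 / lam} \<union> {1 / lam\<^sup>2..})"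

text \<open>
  \<open>G\<close> is the extension to the slit plane of the inverse of \<open>F\<close>, which is a priori only
  a germ at \<open>F 0\<close>.  The last conjunct forces \<open>F\<close> to be locally invertible at \<open>0\<close>,
  so that \<open>0\<close> is a critical point of \<open>f\<close> of degree exactly \<open>l\<close>.
\<close>

definition univalent_inverse_form :: "nat \<Rightarrow> real \<Rightarrow> (complex \<Rightarrow> complex) \<Rightarrow> bool" where
  "univalent_inverse_form l lam f \<longleftrightarrow>
     (\<exists>F G. F analytic_on {0} \<and>
        (\<forall>\<^sub>F z in nhds 0. f z = F (z ^ l)) \<and>
        G holomorphic_on slit_plane lam \<and> inj_on G (slit_plane lam) \<and>
        (\<forall>\<^sub>F w in nhds 0. G (F w) = w))"

text \<open>
  Functions being total, a holomorphic function is given together with its domain: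
  \<open>(f, D)\<close> is the given function and \<open>(h, U)\<close> the extension.
\<close>

definition analytic_extension ::
  "(complex \<Rightarrow> complex) \<Rightarrow> complex set \<Rightarrow> (complex \<Rightarrow> complex) \<Rightarrow> complex set \<Rightarrow> bool" where
  "analytic_extension f D h U \<longleftrightarrow>
     open U \<and> connected U \<and> h holomorphic_on U \<and>
     (\<exists>V. open V \<and> V \<noteq> {} \<and> V \<subseteq> D \<inter> U \<and> (\<forall>z\<in>V. h z = f z))"

definition maximal_analytic_extension ::
  "(complex \<Rightarrow> complex) \<Rightarrow> complex set \<Rightarrow> (complex \<Rightarrow> complex) \<Rightarrow> complex set \<Rightarrow> bool" where
  "maximal_analytic_extension f D h U \<longleftrightarrow>
     analytic_extension f D h U \<and>
     (\<forall>h' U'. analytic_extension f D h' U' \<longrightarrow> U' \<subseteq> U \<and> (\<forall>z\<in>U'. h' z = h z))"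

text \<open>
  Since every iterate is required to lie in \<open>U\<close>, the values of the total function \<open>h\<close>
  outside \<open>U\<close> play no role.
\<close>

definition nonescaping_set :: "(complex \<Rightarrow> complex) \<Rightarrow> complex set \<Rightarrow> complex set" where
  "nonescaping_set h U = {z \<in> U. \<forall>n. (h ^^ n) z \<in> U}"

end

theory Submission
  imports Defs
begin

text \<open>
  Let \<open>C\<close> be the slit plane, \<open>W = {z. z ^ l \<in> G ` C}\<close> and \<open>f0 z = G\<^sup>-\<^sup>1 (z ^ l)\<close>.  Then
  \<open>f0 : W \<rightarrow> C\<close> is an even proper map extending the germ of \<open>f\<close> at \<open>0\<close>, and \<open>0\<close> is the only
  preimage of \<open>1\<close>.  A look at the real axis gives \<open>W \<subseteq> C\<close>, so the domain \<open>Y k\<close> of the \<open>k\<close>-th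
  iterate of \<open>f0\<close> is connected and that iterate is a proper map \<open>Y k \<rightarrow> C\<close>.  By the functional equation
  \<open>(- 1 / lam) ^ n * f0\<^bsup>2 ^ n\<^esup> (lam ^ n * z)\<close> extends the same germ to
  \<open>X n = lam\<^bsup>- n\<^esup> Y (2 ^ n)\<close>, hence \<open>X n \<subseteq> What\<close>.  As this extension is proper over a slit plane
  that exhausts the whole plane for \<open>n \<rightarrow> \<infinity>\<close>, every point of \<open>What\<close> lies in \<open>X n\<close> for all large \<open>n\<close>.
  Since \<open>z \<in> X (n + 1)\<close> iff both \<open>lam * z\<close> and \<open>fhat (lam * z)\<close> lie in \<open>X n\<close>, it follows that
  \<open>z \<in> What\<close> iff both \<open>lam * z\<close> and \<open>fhat (lam * z)\<close> lie in \<open>What\<close>.  With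
  \<open>fhat (fhat (lam * z)) = - lam * fhat z\<close>, this describes the first \<open>2 ^ n\<close> iterates on
  \<open>lam ^ n * What\<close> and shows that the set of nonescaping points is stable under division by \<open>lam\<close>.
\<close>

section \<open>Preimages under the power map\<close>

lemma compact_power_preimage:
  fixes K :: "complex set"
  assumes "compact K" "l > 0"
  shows "compact {z. z ^ l \<in> K}"
proof -
  obtain M where M: "\<And>w. w \<in> K \<Longrightarrow> norm w \<le> M"
    using compact_imp_bounded[OF assms(1)] by (auto simp: bounded_iff)
  have "norm z \<le> max 1 M" if "z ^ l \<in> K" for z
  proof (cases "norm z \<le> 1")
    case False
    then have "norm z ^ 1 \<le> norm z ^ l"
      using assms(2) by (intro power_increasing) auto
    then show ?thesis using M[OF that] by (simp add: norm_power)
  qed auto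
  then have "bounded {z. z ^ l \<in> K}" by (auto simp: bounded_iff)
  moreover have "closed {z. z ^ l \<in> K}"
  proof -
    have "closed ((\<lambda>z. z ^ l) -` K)"
      by (intro closed_vimage compact_imp_closed assms continuous_intros)
    then show ?thesis by (simp add: vimage_def)
  qed
  ultimately show ?thesis by (simp add: compact_eq_bounded_closed)
qed

text \<open>The image of each component is open by the open mapping theorem and relatively closed by
  properness, hence equal to \<open>U\<close>. So each component contains a root of 0, that is, 0
  itself.\<close>

lemma connected_power_preimage:
  fixes U :: "complex set"
  assumes "open U" "connected U" "0 \<in> U" "l > 0"
  shows "connected {z. z ^ l \<in> U}"
proof -
  define B where "B = {z. z ^ l \<in> U}"
  have "open ((\<lambda>z. z ^ l) -` U)"
    by (intro open_vimage assms continuous_intros)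
  then have "open B" by (simp add: vimage_def B_def)
  have "connected_component B z 0" if "z \<in> B" for z
  proof -
    define S where "S = connected_component_set B z"
    have S: "open S" "S \<subseteq> B" "z \<in> S"
      using \<open>open B\<close> that by (auto simp: S_def open_connected_component connected_component_subset)
    have "\<not> (\<lambda>z::complex. z ^ l) constant_on UNIV"
    proof
      assume "(\<lambda>z::complex. z ^ l) constant_on UNIV"
      then obtain c :: complex where "\<And>z. z ^ l = c" by (auto simp: constant_on_def)
      from this[of 0] this[of 1] show False using \<open>l > 0\<close> by (simp add: zero_power)
    qed
    then have "open ((\<lambda>z. z ^ l) ` S)"
      by (intro open_mapping_thm[of _ UNIV]) (auto simp: S intro!: holomorphic_intros)
    moreover have sub: "(\<lambda>z. z ^ l) ` S \<subseteq> U" using S by (auto simp: B_def)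
    ultimately have "openin (top_of_set U) ((\<lambda>z. z ^ l) ` S)"
      using open_subset by blast
    moreover have "closedin (top_of_set U) ((\<lambda>z. z ^ l) ` S)"
      unfolding closedin_limpt
    proof (intro conjI allI impI)
      fix w
      assume "w islimpt (\<lambda>z. z ^ l) ` S \<and> w \<in> U"
      then obtain x :: "nat \<Rightarrow> complex"
        where *: "(\<forall>n. x n \<in> (\<lambda>z. z ^ l) ` S) \<and> w \<in> U \<and> x \<longlonglongrightarrow> w"
        unfolding islimpt_sequential by blast
      then have "\<forall>n. \<exists>s. s \<in> S \<and> x n = s ^ l" by blast
      then obtain s where s: "\<And>n. s n \<in> S" "\<And>n. x n = s n ^ l" by metis
      \<comment> \<open>The sequence together with its limit is compact, so the chosen roots have a
        convergent subsequence; the limit stays in \<open>S\<close> because components are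
        relatively closed in \<open>B\<close>.\<close>
      have "compact {z. z ^ l \<in> insert w (range x)}"
        using * \<open>l > 0\<close> by (intro compact_power_preimage compact_sequence_with_limit) auto
      moreover have "s n \<in> {z. z ^ l \<in> insert w (range x)}" for n
        using s by auto
      ultimately obtain s' r where r: "strict_mono r" "(s \<circ> r) \<longlonglongrightarrow> s'"
        unfolding compact_def by blast
      have "(\<lambda>n. (s \<circ> r) n ^ l) \<longlonglongrightarrow> s' ^ l"
        by (intro tendsto_intros r)
      moreover have "(\<lambda>n. (s \<circ> r) n ^ l) \<longlonglongrightarrow> w"
        using LIMSEQ_subseq_LIMSEQ[of x w r] * r s by (simp add: o_def)
      ultimately have "s' ^ l = w" using LIMSEQ_unique by blast
      then have "s' \<in> B" using * by (simp add: B_def)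
      have "closedin (top_of_set B) S"
        unfolding S_def by (rule closedin_connected_component)
      then obtain T where "closed T" "S = B \<inter> T"
        unfolding closedin_closed by blast
      moreover have "s' \<in> T" if "closed T" "S = B \<inter> T" for T
        by (rule closed_sequentially[OF that(1) _ r(2)]) (use s that in auto)
      ultimately have "s' \<in> S" using \<open>s' \<in> B\<close> by blast
      then show "w \<in> (\<lambda>z. z ^ l) ` S" using \<open>s' ^ l = w\<close> by blast
    qed (use sub in auto)
    ultimately have "(\<lambda>z. z ^ l) ` S = U"
      using assms(2) S unfolding connected_clopen by blast
    then have "0 \<in> (\<lambda>z. z ^ l) ` S" using assms(3) by simp
    then have "0 \<in> S" using \<open>l > 0\<close> by auto
    then show ?thesis by (simp add: S_def)
  qed
  then show ?thesis
    unfolding connected_iff_connected_component B_def[symmetric]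
    by (meson connected_component_sym connected_component_trans)
qed

section \<open>Topology of the slit plane\<close>

lemma slit_plane_iff:
  "z \<in> slit_plane lam \<longleftrightarrow> (Im z = 0 \<longrightarrow> - 1 / lam < Re z \<and> Re z < 1 / lam\<^sup>2)"
  unfolding slit_plane_def by (auto simp: image_iff complex_eq_iff)

lemma open_slit_plane: "open (slit_plane lam)"
proof -
  have "closed ({z. Im z = 0} \<inter> ({z. Re z \<le> - 1 / lam} \<union> {z. Re z \<ge> 1 / lam\<^sup>2}))"
    by (intro closed_Int closed_Un closed_Collect_eq closed_Collect_le continuous_intros)
  moreover have "slit_plane lam =
      - ({z. Im z = 0} \<inter> ({z. Re z \<le> - 1 / lam} \<union> {z. Re z \<ge> 1 / lam\<^sup>2}))"
    by (auto simp: slit_plane_iff)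
  ultimately show ?thesis by (simp add: open_closed)
qed

lemma connected_slit_plane:
  assumes "lam > 0"
  shows "connected (slit_plane lam)"
proof (rule starlike_imp_connected)
  have "t *\<^sub>R z \<in> slit_plane lam" if z: "z \<in> slit_plane lam" and t: "0 \<le> t" "t \<le> 1" for z t
  proof (cases "t = 0 \<or> Im z \<noteq> 0")
    case True
    then show ?thesis using assms by (auto simp: slit_plane_iff)
  next
    case False
    then have b: "- 1 / lam < Re z" "Re z < 1 / lam\<^sup>2"
      using z by (auto simp: slit_plane_iff)
    have p: "0 < 1 / lam" "0 < 1 / lam\<^sup>2" using assms by auto
    have "- 1 / lam < t * Re z"
    proof (cases "Re z \<ge> 0")
      case True
      then have "0 \<le> t * Re z" using t by simp
      then show ?thesis using p by linarith
    next
      case False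
      then have "Re z \<le> t * Re z" using t by (simp add: mult_le_cancel_right1)
      then show ?thesis using b by linarith
    qed
    moreover have "t * Re z < 1 / lam\<^sup>2"
    proof (cases "Re z \<ge> 0")
      case True
      then have "t * Re z \<le> Re z" using t by (simp add: mult_left_le_one_le)
      then show ?thesis using b by linarith
    next
      case False
      then have "t * Re z \<le> 0" using t by (simp add: mult_nonneg_nonpos)
      then show ?thesis using p by linarith
    qed
    ultimately show ?thesis by (simp add: slit_plane_iff)
  qed
  then show "starlike (slit_plane lam)"
    using assms unfolding starlike_def
    by (intro bexI[of _ 0]) (auto simp: closed_segment_def slit_plane_iff)
qed


section \<open>The map \<open>f0\<close> and its preimages\<close>

text \<open>\<open>F\<close> is eliminated: its inverse \<open>G\<close> enters through the germ
  identity \<open>G (f z) = z ^ l\<close>, and the real dynamics through the invariance of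
  [-1, 1].\<close>

locale feigenbaum =
  fixes l :: nat and lam :: real
    and f fhat G :: "complex \<Rightarrow> complex" and D What :: "complex set"
  assumes l_even: "even l" and l_pos: "l > 0"
    and lam_pos: "0 < lam" and lam_less_1: "lam < 1"
    and open_D: "open D" and connected_D: "connected D" and D_interval: "of_real ` {-1..1} \<subseteq> D"
    and f_hol: "f holomorphic_on D"
    and f_interval: "f ` of_real ` {-1..1} \<subseteq> of_real ` {-1..1}"
    and f_0: "f 0 = 1" and f_1: "f 1 = - of_real lam"
    and f_eq: "\<forall>\<^sub>F z in nhds 0. f z = - (1 / of_real lam) * f (f (of_real lam * z))"
    and G_hol: "G holomorphic_on slit_plane lam" and G_inj: "inj_on G (slit_plane lam)"
    and G_f: "\<forall>\<^sub>F z in nhds 0. G (f z) = z ^ l"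
    and maximal: "maximal_analytic_extension f D fhat What"
begin

abbreviation L :: complex where "L \<equiv> of_real lam"

definition I :: "complex set" where
  "I = {z. Im z = 0 \<and> \<bar>Re z\<bar> \<le> 1}"

definition W :: "complex set" where
  "W = {z. z ^ l \<in> G ` slit_plane lam}"

text \<open>Outside \<open>W\<close> the value of \<open>inv_into\<close> is arbitrary, so an
  iterate is meaningful only while the orbit stays in \<open>W\<close>.\<close>

definition f0 :: "complex \<Rightarrow> complex" where
  "f0 z = inv_into (slit_plane lam) G (z ^ l)"

lemma lam_nonzero [simp]: "lam \<noteq> 0"
  using lam_pos by simp

lemma one_less_inverse_lam: "1 < 1 / lam" "1 / lam < 1 / lam\<^sup>2"
  using lam_pos lam_less_1 by (auto simp: field_simps power2_eq_square)

lemma I_eq: "I = of_real ` {-1..1}"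
  by (auto simp: I_def abs_le_iff complex_eq_iff image_iff Bex_def)

lemma zero_in_I: "0 \<in> I" and one_in_I: "1 \<in> I"
  by (auto simp: I_def)

lemma I_scale: "x \<in> I \<Longrightarrow> 0 \<le> t \<Longrightarrow> t \<le> 1 \<Longrightarrow> of_real t * x \<in> I"
  by (simp add: I_def abs_mult mult_le_one)

lemma connected_I: "connected I"
  unfolding I_eq by (intro connected_continuous_image continuous_intros) auto

lemma I_subset_slit_plane: "I \<subseteq> slit_plane lam"
  using one_less_inverse_lam by (auto simp: slit_plane_iff I_def abs_le_iff)

lemma I_subset_D: "I \<subseteq> D"
  using D_interval by (simp add: I_eq)

lemma f_I: "x \<in> I \<Longrightarrow> f x \<in> I"
  using f_interval unfolding I_eq by blast

lemma f_cont: "continuous_on D f"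
  using f_hol by (rule holomorphic_on_imp_continuous_on)

lemma G_cont: "continuous_on (slit_plane lam) G"
  using G_hol by (rule holomorphic_on_imp_continuous_on)

lemma connected_f_I: "connected (f ` I)"
  using continuous_on_subset[OF f_cont I_subset_D] connected_I
  by (rule connected_continuous_image)

lemma G_1: "G 1 = 0"
  using eventually_nhds_x_imp_x[OF G_f] l_pos by (simp add: f_0 zero_power)

lemma f0_in_slit_plane: "z \<in> W \<Longrightarrow> f0 z \<in> slit_plane lam"
  unfolding W_def f0_def by (simp add: inv_into_into)

lemma G_f0: "z \<in> W \<Longrightarrow> G (f0 z) = z ^ l"
  unfolding W_def f0_def by (simp add: f_inv_into_f)

lemma f0_eqI: "v \<in> slit_plane lam \<Longrightarrow> G v = z ^ l \<Longrightarrow> z \<in> W \<and> f0 z = v"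
  unfolding W_def f0_def using G_inj by (metis image_eqI inv_into_f_f mem_Collect_eq)

text \<open>Reduces preimages under \<open>f0\<close> to preimages under the power map, where
  compactness and connectedness are already known.\<close>

lemma f0_preimage_eq:
  assumes "A \<subseteq> slit_plane lam"
  shows "{z \<in> W. f0 z \<in> A} = {z. z ^ l \<in> G ` A}"
proof (intro equalityI subsetI)
  fix z assume "z \<in> {z \<in> W. f0 z \<in> A}"
  then show "z \<in> {z. z ^ l \<in> G ` A}" using G_f0[of z] by (auto intro: image_eqI[of _ G "f0 z"])
next
  fix z assume "z \<in> {z. z ^ l \<in> G ` A}"
  then obtain v where "v \<in> A" "G v = z ^ l" by auto
  then show "z \<in> {z \<in> W. f0 z \<in> A}" using f0_eqI[of v z] assms by auto
qed

lemma minus_power_l: "(- z) ^ l = z ^ l" for z :: complex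
  using l_even by simp

lemma f0_minus: "f0 (- z) = f0 z" and W_minus: "- z \<in> W \<longleftrightarrow> z \<in> W"
  by (simp_all add: f0_def W_def minus_power_l)

lemma open_G_image: "open A \<Longrightarrow> A \<subseteq> slit_plane lam \<Longrightarrow> open (G ` A)"
  using G_hol G_inj by (intro open_mapping_thm3) (auto intro: holomorphic_on_subset inj_on_subset)

lemma open_f0_preimage:
  assumes "open A" "A \<subseteq> slit_plane lam"
  shows "open {z \<in> W. f0 z \<in> A}"
proof -
  have "open ((\<lambda>z. z ^ l) -` (G ` A))"
    by (intro open_vimage open_G_image assms continuous_intros)
  then show ?thesis by (simp add: f0_preimage_eq[OF assms(2)] vimage_def)
qed

lemma open_W: "open W"
proof -
  have "W = {z \<in> W. f0 z \<in> slit_plane lam}" using f0_in_slit_plane by blast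
  then show ?thesis using open_f0_preimage[OF open_slit_plane subset_refl] by simp
qed

text \<open>Every component of the preimage is mapped onto \<open>A\<close>, and \<open>0\<close> is the only preimage of \<open>1\<close>.\<close>

lemma connected_f0_preimage:
  assumes "open A" "connected A" "A \<subseteq> slit_plane lam" "1 \<in> A"
  shows "connected {z \<in> W. f0 z \<in> A}"
  unfolding f0_preimage_eq[OF assms(3)]
proof (rule connected_power_preimage)
  show "connected (G ` A)"
    using continuous_on_subset[OF G_cont assms(3)] assms(2) by (rule connected_continuous_image)
  show "0 \<in> G ` A" using G_1 assms(4) by force
qed (use assms open_G_image l_pos in auto)

lemma compact_f0_preimage:
  assumes "compact K" "K \<subseteq> slit_plane lam"
  shows "compact {z \<in> W. f0 z \<in> K}"
  unfolding f0_preimage_eq[OF assms(2)]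
proof (rule compact_power_preimage)
  show "compact (G ` K)"
    using continuous_on_subset[OF G_cont assms(2)] assms(1) by (rule compact_continuous_image)
qed (fact l_pos)

lemma f0_hol: "f0 holomorphic_on W"
proof -
  obtain g where g: "g holomorphic_on (G ` slit_plane lam)" "\<And>z. z \<in> slit_plane lam \<Longrightarrow> g (G z) = z"
    using holomorphic_has_inverse[OF G_hol open_slit_plane G_inj] by metis
  have "g \<circ> (\<lambda>z. z ^ l) holomorphic_on W"
    using g(1) by (intro holomorphic_on_compose_gen[where t = "G ` slit_plane lam"])
      (auto intro!: holomorphic_intros simp: W_def)
  moreover have "(g \<circ> (\<lambda>z. z ^ l)) z = f0 z" if "z \<in> W" for z
    using g(2)[OF f0_in_slit_plane[OF that]] G_f0[OF that] by simp
  ultimately show ?thesis by (simp cong: holomorphic_cong)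
qed

text \<open>The identity \<open>G (f z) = z ^ l\<close> near 0 continues analytically over the
  component of 0 in \<open>P\<close>, which contains the connected set \<open>I\<close>.\<close>

lemma f0_eq_f:
  obtains S where "open S" "I \<subseteq> S" "S \<subseteq> D" "S \<subseteq> W" "\<And>z. z \<in> S \<Longrightarrow> f0 z = f z"
proof -
  define P where "P = D \<inter> f -` slit_plane lam"
  have "open P"
    unfolding P_def using f_cont open_D open_slit_plane by (rule continuous_open_preimage)
  have "I \<subseteq> P"
    using I_subset_D f_I I_subset_slit_plane unfolding P_def by blast
  define S where "S = connected_component_set P 0"
  have "0 \<in> S"
    using \<open>I \<subseteq> P\<close> zero_in_I by (auto simp: S_def)
  have S: "open S" "connected S" "S \<subseteq> P" "I \<subseteq> S"
    unfolding S_def using \<open>open P\<close> connected_component_maximal[OF zero_in_I connected_I \<open>I \<subseteq> P\<close>]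
    by (simp_all add: open_connected_component connected_component_subset)
  obtain N where N: "open N" "0 \<in> N" "\<And>z. z \<in> N \<Longrightarrow> G (f z) = z ^ l"
    using G_f unfolding eventually_nhds by blast
  have "G (f z) = z ^ l" if "z \<in> S" for z
  proof (rule analytic_continuation_open[of "N \<inter> S" S "\<lambda>z. G (f z)"])
    have "G \<circ> f holomorphic_on S"
      using S(3) G_hol f_hol
      by (intro holomorphic_on_compose_gen[where t = "slit_plane lam"])
        (auto simp: P_def intro: holomorphic_on_subset)
    then show "(\<lambda>z. G (f z)) holomorphic_on S" by (simp add: o_def)
  qed (use N S \<open>0 \<in> S\<close> that in \<open>auto intro!: holomorphic_intros\<close>)
  then have "z \<in> W \<and> f0 z = f z" if "z \<in> S" for z
    using S(3) that by (intro f0_eqI) (auto simp: P_def)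
  then show thesis
    using that[of S] S by (auto simp: P_def)
qed

lemma I_subset_W: "I \<subseteq> W" and f0_I: "x \<in> I \<Longrightarrow> f0 x = f x"
  by (metis f0_eq_f subsetD subsetI)+

section \<open>Conjugation symmetry and the real points of \<open>W\<close>\<close>

lemma cnj_slit_plane: "cnj v \<in> slit_plane lam \<longleftrightarrow> v \<in> slit_plane lam"
  by (simp add: slit_plane_iff)

text \<open>Identity theorem on the image of \<open>I\<close> under \<open>f\<close>: there
  \<open>G\<close> takes the real values \<open>x ^ l\<close> at real points.\<close>

lemma G_cnj:
  assumes "v \<in> slit_plane lam"
  shows "G (cnj v) = cnj (G v)"
proof -
  have cnj_image: "cnj ` slit_plane lam = slit_plane lam"
    using cnj_slit_plane by (metis image_eqI complex_cnj_cnj subsetI subset_antisym image_subsetI)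
  have "(cnj \<circ> G \<circ> cnj) v - G v = 0"
  proof (rule analytic_continuation[of "\<lambda>v. (cnj \<circ> G \<circ> cnj) v - G v" "slit_plane lam" "f ` I" 1])
    show "(\<lambda>v. (cnj \<circ> G \<circ> cnj) v - G v) holomorphic_on slit_plane lam"
      by (intro holomorphic_intros holomorphic_on_compose_cnj_cnj)
        (use G_hol open_slit_plane cnj_image in auto)
    \<comment> \<open>A connected set with two distinct points has no isolated points.\<close>
    have "1 \<in> f ` I" "- L \<in> f ` I"
      using imageI[OF zero_in_I, of f] imageI[OF one_in_I, of f] by (simp_all add: f_0 f_1)
    moreover have "- L \<noteq> 1"
      using lam_pos by (auto simp: complex_eq_iff)
    ultimately have "\<nexists>a. f ` I = {a}" by (metis singletonD)
    then show "1 islimpt f ` I"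
      using \<open>1 \<in> f ` I\<close> connected_f_I by (intro connected_imp_perfect) auto
    show "f ` I \<subseteq> slit_plane lam"
      using f_I I_subset_slit_plane by blast
    show "(cnj \<circ> G \<circ> cnj) v - G v = 0" if vI: "v \<in> f ` I" for v
    proof -
      obtain x where x: "v = f x" "x \<in> I" using vI by blast
      then have "G v = x ^ l"
        using G_f0 f0_I I_subset_W by (metis subsetD)
      moreover have "cnj x = x" "cnj v = v"
        using x f_I[of x] by (auto simp: I_def complex_eq_iff)
      ultimately show ?thesis by simp
    qed
  qed (use assms open_slit_plane connected_slit_plane[OF lam_pos] I_subset_slit_plane one_in_I in auto)
  then have "cnj (G (cnj v)) = G v" by simp
  then show ?thesis by (metis complex_cnj_cnj)
qed

text \<open>By symmetry and injectivity of \<open>G\<close>, the point \<open>f0 z\<close> is real.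
  Along the real segment from it to 1, \<open>G\<close> runs from
  \<open>\<bar>Re z\<bar> ^ l\<close> to 0 and so attains \<open>t ^ l\<close>.\<close>

lemma real_interval_subset_W:
  assumes "z \<in> W" "Im z = 0" "0 \<le> t" "t \<le> \<bar>Re z\<bar>"
  shows "of_real t \<in> W"
proof -
  define v where "v = f0 z"
  have zr: "z ^ l = of_real (\<bar>Re z\<bar> ^ l)"
  proof -
    have "z = of_real (Re z)" using assms(2) by (simp add: complex_eq_iff)
    then have "z ^ l = of_real (Re z) ^ l" by argo
    also have "\<dots> = of_real (Re z ^ l)" by simp
    also have "Re z ^ l = \<bar>Re z\<bar> ^ l" using l_even by (simp add: power_even_abs)
    finally show ?thesis .
  qed
  have v: "v \<in> slit_plane lam" "G v = of_real (\<bar>Re z\<bar> ^ l)"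
    using f0_in_slit_plane[OF assms(1)] G_f0[OF assms(1)] zr by (auto simp: v_def)
  then have "G (cnj v) = G v" by (simp add: G_cnj)
  then have "cnj v = v"
    using G_inj v(1) cnj_slit_plane by (meson inj_onD)
  then have "Im v = 0" by (simp add: complex_eq_iff)
  have seg: "closed_segment v 1 \<subseteq> {u \<in> slit_plane lam. Im u = 0}"
  proof
    fix u assume "u \<in> closed_segment v 1"
    then obtain s where s: "0 \<le> s" "s \<le> 1" "u = (1 - s) *\<^sub>R v + s *\<^sub>R 1"
      by (auto simp: closed_segment_def)
    have "Re u \<in> closed_segment (Re v) 1"
      using s by (auto simp: closed_segment_def)
    then have "min (Re v) 1 \<le> Re u" "Re u \<le> max (Re v) 1"
      by (auto simp: closed_segment_eq_real_ivl split: if_splits)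
    moreover have "Im u = 0" using s(3) \<open>Im v = 0\<close> by simp
    ultimately show "u \<in> {u \<in> slit_plane lam. Im u = 0}"
      using v(1) \<open>Im v = 0\<close> one_less_inverse_lam by (auto simp: slit_plane_iff)
  qed
  have "connected ((\<lambda>u. Re (G u)) ` closed_segment v 1)"
    using seg by (intro connected_continuous_image continuous_on_Re continuous_on_subset[OF G_cont]) auto
  moreover have "0 \<in> (\<lambda>u. Re (G u)) ` closed_segment v 1"
    using G_1 by (intro image_eqI[of _ _ 1]) auto
  moreover have "\<bar>Re z\<bar> ^ l \<in> (\<lambda>u. Re (G u)) ` closed_segment v 1"
    using v(2) by (intro image_eqI[of _ _ v]) auto
  moreover have "0 \<le> t ^ l" "t ^ l \<le> \<bar>Re z\<bar> ^ l"
    using assms(3,4) by (auto intro: power_mono)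
  ultimately have "t ^ l \<in> (\<lambda>u. Re (G u)) ` closed_segment v 1"
    unfolding connected_iff_interval by blast
  then obtain u where u: "u \<in> slit_plane lam" "Im u = 0" "Re (G u) = t ^ l"
    using seg by auto
  have "cnj u = u" using u(2) by (simp add: complex_eq_iff)
  then have "cnj (G u) = G u" using G_cnj[OF u(1)] by simp
  then have "G u = of_real t ^ l" using u(3) by (simp add: complex_eq_iff flip: of_real_power)
  then show ?thesis using f0_eqI[OF u(1)] by blast
qed

text \<open>
  If \<open>W\<close> contained the interval from \<open>0\<close> to \<open>1 / lam\<close>, the functional equation would hold there, and
  for a zero \<open>x\<close> of \<open>f\<close> it would give \<open>f0 (x / lam) = - 1 / lam\<close>, which is on the slit.
\<close>

lemma W_real_bound:
  assumes "z \<in> W" "Im z = 0"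
  shows "\<bar>Re z\<bar> < 1 / lam"
proof (rule ccontr)
  assume "\<not> \<bar>Re z\<bar> < 1 / lam"
  then have W': "of_real t \<in> W" if "0 \<le> t" "t \<le> 1 / lam" for t
    using real_interval_subset_W[OF assms, of t] that by linarith
  obtain S where S: "open S" "I \<subseteq> S" "S \<subseteq> D" "S \<subseteq> W" "\<And>z. z \<in> S \<Longrightarrow> f0 z = f z"
    using f0_eq_f by blast
  define P where "P = W \<inter> (\<lambda>y. L * y) -` (D \<inter> f -` D)"
  have "open (D \<inter> f -` D)"
    using f_cont open_D open_D by (rule continuous_open_preimage)
  then have "open P"
    unfolding P_def by (rule open_Int[OF open_W open_vimage]) (intro continuous_intros)
  define J :: "complex set" where "J = of_real ` {0..1 / lam}"
  have LJ: "L * y \<in> I" if y: "y \<in> J" for y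
  proof -
    obtain t where "y = of_real t" "0 \<le> t" "t \<le> 1 / lam"
      using y unfolding J_def image_iff Bex_def atLeastAtMost_iff by blast
    then have "0 \<le> lam * t" "lam * t \<le> 1" "Re y = t" "Im y = 0"
      using lam_pos by (auto simp: field_simps)
    then show ?thesis by (simp add: I_def)
  qed
  have "J \<subseteq> P"
    using LJ W' I_subset_D f_I unfolding P_def J_def by fastforce
  have "connected J"
    unfolding J_def by (intro connected_continuous_image continuous_intros) auto
  have "0 \<in> J" using lam_pos by (auto simp: J_def intro!: image_eqI[of _ _ 0])
  define T where "T = connected_component_set P 0"
  have "0 \<in> T"
    using \<open>J \<subseteq> P\<close> \<open>0 \<in> J\<close> by (auto simp: T_def)
  have T: "open T" "connected T" "T \<subseteq> P" "J \<subseteq> T"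
    unfolding T_def
    using \<open>open P\<close> connected_component_maximal[OF \<open>0 \<in> J\<close> \<open>connected J\<close> \<open>J \<subseteq> P\<close>]
    by (simp_all add: open_connected_component connected_component_subset)
  obtain N where N: "open N" "0 \<in> N" "\<And>z. z \<in> N \<Longrightarrow> f z = - (1 / L) * f (f (L * z))"
    using f_eq unfolding eventually_nhds by blast
  \<comment> \<open>Both sides are holomorphic on the connected neighbourhood \<open>T\<close> of
    \<open>J\<close> and agree near 0.\<close>
  have eq: "f0 y = - (1 / L) * f (f (L * y))" if "y \<in> T" for y
  proof (rule analytic_continuation_open[of "N \<inter> S \<inter> T" T f0])
    show "f0 holomorphic_on T"
      using f0_hol T(3) by (auto simp: P_def intro: holomorphic_on_subset)
    have "f \<circ> (f \<circ> (\<lambda>y. L * y)) holomorphic_on T"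
      using T(3) f_hol
      by (intro holomorphic_on_compose_gen[where t = D])
        (auto simp: P_def intro!: holomorphic_intros)
    then show "(\<lambda>y. - (1 / L) * f (f (L * y))) holomorphic_on T"
      by (intro holomorphic_intros) (simp add: o_def)
    have "0 \<in> N \<inter> S \<inter> T" using N S(2) zero_in_I \<open>0 \<in> T\<close> by blast
    then show "N \<inter> S \<inter> T \<noteq> {}" by blast
  qed (use N S T that in auto)
  have "\<exists>x\<ge>0. x \<le> 1 \<and> Re (f (of_real x)) = 0"
  proof (rule IVT2')
    have "continuous_on (of_real ` {0..1}) f"
      using I_subset_D by (intro continuous_on_subset[OF f_cont]) (auto simp: I_eq)
    then have "continuous_on {0..1} (\<lambda>x. f (of_real x))"
      by (rule continuous_on_compose2) (auto intro: continuous_intros)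
    then show "continuous_on {0..1} (\<lambda>x. Re (f (of_real x)))"
      by (rule continuous_on_Re)
  qed (use f_0 f_1 lam_pos in auto)
  then obtain x where x: "0 \<le> x" "x \<le> 1" "Re (f (of_real x)) = 0" by blast
  then have "f (of_real x) = 0"
    using f_I[of "of_real x"] by (simp add: I_def complex_eq_iff)
  moreover have J: "of_real (x / lam) \<in> J"
    unfolding J_def by (rule imageI) (use x lam_pos in \<open>simp add: divide_right_mono\<close>)
  ultimately have "f0 (of_real (x / lam)) = - (1 / L)"
    using eq[of "of_real (x / lam)"] T(4) by (auto simp: f_0)
  moreover have "of_real (x / lam) \<in> W"
    using J T by (auto simp: P_def)
  ultimately have "- (1 / L) \<in> slit_plane lam"
    using f0_in_slit_plane by metis
  then show False by (simp add: slit_plane_iff Re_divide_of_real)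
qed

lemma W_subset_slit_plane: "W \<subseteq> slit_plane lam"
proof
  fix z assume "z \<in> W"
  then show "z \<in> slit_plane lam"
    using W_real_bound[of z] one_less_inverse_lam by (auto simp: slit_plane_iff)
qed

section \<open>Iterates of \<open>f0\<close>\<close>

text \<open>The bound on \<open>i\<close> is strict: the \<open>k\<close>-th iterate itself need not
  lie in \<open>W\<close>.\<close>

definition Y :: "nat \<Rightarrow> complex set" where
  "Y k = {z. \<forall>i<k. (f0 ^^ i) z \<in> W}"

lemma Y_0 [simp]: "Y 0 = UNIV"
  by (simp add: Y_def)

lemma Y_Suc: "z \<in> Y (Suc k) \<longleftrightarrow> z \<in> W \<and> f0 z \<in> Y k"
  by (simp add: Y_def All_less_Suc2 funpow_Suc_right del: funpow.simps(2))

lemma Y_add: "z \<in> Y (a + b) \<longleftrightarrow> z \<in> Y a \<and> (f0 ^^ a) z \<in> Y b"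
  by (induction a arbitrary: z) (auto simp: Y_Suc funpow_Suc_right simp del: funpow.simps(2))

lemma Y_subset_W: "k > 0 \<Longrightarrow> Y k \<subseteq> W"
  by (cases k) (auto simp: Y_Suc)

text \<open>As \<open>W\<close> lies in the slit plane, the intersection changes only
  \<open>Y 0\<close>; it makes each further step a preimage under \<open>f0\<close> of an open
  connected set containing 1.\<close>

lemma Y_Int_slit_plane:
  "open (Y k \<inter> slit_plane lam) \<and> connected (Y k \<inter> slit_plane lam) \<and> I \<subseteq> Y k \<inter> slit_plane lam"
proof (induction k)
  case 0
  then show ?case
    using open_slit_plane connected_slit_plane[OF lam_pos] I_subset_slit_plane by simp
next
  case (Suc k)
  have eq: "Y (Suc k) \<inter> slit_plane lam = {z \<in> W. f0 z \<in> Y k \<inter> slit_plane lam}"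
    using W_subset_slit_plane f0_in_slit_plane by (auto simp: Y_Suc)
  have "I \<subseteq> {z \<in> W. f0 z \<in> Y k \<inter> slit_plane lam}"
    using Suc I_subset_W f0_I f_I by fastforce
  then show ?case
    unfolding eq using Suc one_in_I open_f0_preimage connected_f0_preimage by blast
qed

lemma Y_minus: "k > 0 \<Longrightarrow> - z \<in> Y k \<longleftrightarrow> z \<in> Y k"
  by (cases k) (auto simp: Y_Suc f0_minus W_minus)

lemma f0_funpow_minus: "k > 0 \<Longrightarrow> (f0 ^^ k) (- z) = (f0 ^^ k) z"
  by (cases k) (auto simp: f0_minus funpow_Suc_right simp del: funpow.simps(2))

text \<open>Pull back by \<open>f0\<close> one step at a time. The inclusion is carried along
  because \<open>compact_f0_preimage\<close> requires a compact set inside the slit plane.\<close>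

lemma compact_Y_preimage:
  assumes "compact K" "K \<subseteq> slit_plane lam"
  shows "compact {z \<in> Y k. (f0 ^^ k) z \<in> K} \<and> {z \<in> Y k. (f0 ^^ k) z \<in> K} \<subseteq> slit_plane lam"
proof (induction k)
  case 0
  then show ?case using assms by simp
next
  case (Suc k)
  have eq: "{z \<in> Y (Suc k). (f0 ^^ Suc k) z \<in> K} = {z \<in> W. f0 z \<in> {z \<in> Y k. (f0 ^^ k) z \<in> K}}"
    by (auto simp: Y_Suc funpow_Suc_right simp del: funpow.simps(2))
  show ?case
    unfolding eq using Suc compact_f0_preimage W_subset_slit_plane by blast
qed

text \<open>Renormalization produces powers of \<open>- L\<close> while \<open>X n\<close> is scaled
  by powers of \<open>L\<close>; evenness of \<open>f0\<close> absorbs the sign.\<close>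

lemma minus_L_power: "(- L) ^ n * y = L ^ n * y \<or> (- L) ^ n * y = - (L ^ n * y)"
  by (cases "even n") simp_all

lemma f0_funpow_sign: "k > 0 \<Longrightarrow> (f0 ^^ k) ((- L) ^ n * y) = (f0 ^^ k) (L ^ n * y)"
  using minus_L_power[of n y] f0_funpow_minus by metis

lemma Y_sign: "k > 0 \<Longrightarrow> (- L) ^ n * y \<in> Y k \<longleftrightarrow> L ^ n * y \<in> Y k"
  using minus_L_power[of n y] Y_minus by metis

section \<open>The rescaled domains \<open>X n\<close>\<close>

definition X :: "nat \<Rightarrow> complex set" where
  "X n = {z. L ^ n * z \<in> Y (2 ^ n)}"

lemma X_minus: "- z \<in> X n \<longleftrightarrow> z \<in> X n"
  by (simp add: X_def Y_minus)

lemma X_image: "{z. L ^ n * z \<in> A} = (\<lambda>z. z / L ^ n) ` A"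
proof (intro equalityI subsetI)
  fix z assume "z \<in> {z. L ^ n * z \<in> A}"
  then show "z \<in> (\<lambda>z. z / L ^ n) ` A"
    by (intro image_eqI[of _ _ "L ^ n * z"]) auto
qed auto

lemma Y_power_Int: "Y (2 ^ n) \<inter> slit_plane lam = Y (2 ^ n)"
  using Y_subset_W[of "2 ^ n"] W_subset_slit_plane by auto

lemma open_X: "open (X n)"
proof -
  have "open ((\<lambda>z. L ^ n * z) -` Y (2 ^ n))"
    using Y_Int_slit_plane[of "2 ^ n"] unfolding Y_power_Int
    by (intro open_vimage continuous_intros) auto
  then show ?thesis by (simp add: X_def vimage_def)
qed

lemma connected_X: "connected (X n)"
  unfolding X_def X_image
  using Y_Int_slit_plane[of "2 ^ n"] unfolding Y_power_Int
  by (intro connected_continuous_image continuous_intros) auto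

lemma I_subset_X: "I \<subseteq> X n"
proof
  fix x assume "x \<in> I"
  then have "L ^ n * x \<in> I"
    using I_scale[of x "lam ^ n"] lam_pos lam_less_1 by (simp add: power_le_one)
  then show "x \<in> X n"
    using Y_Int_slit_plane[of "2 ^ n"] by (auto simp: X_def)
qed

section \<open>The maximal extension on \<open>X n\<close>\<close>

lemma open_What: "open What" and connected_What: "connected What"
  and fhat_hol: "fhat holomorphic_on What"
  using maximal by (auto simp: maximal_analytic_extension_def analytic_extension_def)

lemma analytic_extensionD:
  "analytic_extension f D h U \<Longrightarrow> U \<subseteq> What \<and> (\<forall>z\<in>U. h z = fhat z)"
  using maximal by (auto simp: maximal_analytic_extension_def)

lemma D_subset_What: "D \<subseteq> What" and fhat_eq_f: "z \<in> D \<Longrightarrow> fhat z = f z"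
proof -
  have "analytic_extension f D f D"
    unfolding analytic_extension_def
    using open_D connected_D f_hol zero_in_I I_subset_D by blast
  then show "D \<subseteq> What" "z \<in> D \<Longrightarrow> fhat z = f z"
    using analytic_extensionD by auto
qed

lemma extend_at_0:
  assumes "open U" "connected U" "h holomorphic_on U" "0 \<in> U" "\<forall>\<^sub>F z in nhds 0. h z = f z"
  shows "U \<subseteq> What \<and> (\<forall>z\<in>U. h z = fhat z)"
proof -
  obtain N where N: "open N" "0 \<in> N" "\<And>z. z \<in> N \<Longrightarrow> h z = f z"
    using assms(5) unfolding eventually_nhds by blast
  have "open (N \<inter> D \<inter> U)" "0 \<in> N \<inter> D \<inter> U"
    using N open_D assms(1,4) zero_in_I I_subset_D by auto
  then have "analytic_extension f D h U"
    unfolding analytic_extension_def using assms N by blast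
  then show ?thesis by (rule analytic_extensionD)
qed

text \<open>The assumptions are the induction claim of \<open>X_extension\<close> at level
  \<open>n\<close>; their consequences serve its induction step and, once it is proved, hold for
  every \<open>n\<close>.\<close>

context
  fixes n :: nat
  assumes X_subset: "X n \<subseteq> What"
    and X_fhat: "\<And>z. z \<in> X n \<Longrightarrow> (f0 ^^ (2 ^ n)) (L ^ n * z) = (- L) ^ n * fhat z"
begin

text \<open>Split the iterates into two blocks of length \<open>2 ^ n\<close>; the second block
  starts at \<open>(- L) ^ n * fhat (L * z)\<close>.\<close>

lemma X_Suc_iff: "z \<in> X (Suc n) \<longleftrightarrow> L * z \<in> X n \<and> fhat (L * z) \<in> X n"
proof (cases "L * z \<in> X n")
  case True
  then show ?thesis
    using X_fhat[OF True]
    by (simp add: X_def Y_add Y_sign mult_2 mult.assoc mult.commute[of L])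
next
  case False
  then show ?thesis by (simp add: X_def Y_add mult_2 mult.assoc mult.commute[of L])
qed

lemma X_Suc_fhat:
  assumes "z \<in> X (Suc n)"
  shows "(f0 ^^ (2 ^ Suc n)) (L ^ Suc n * z) = (- L) ^ n * fhat (fhat (L * z))"
proof -
  have z: "L * z \<in> X n" "fhat (L * z) \<in> X n" using assms X_Suc_iff by auto
  have "(f0 ^^ (2 ^ Suc n)) (L ^ Suc n * z) = (f0 ^^ (2 ^ n)) ((f0 ^^ (2 ^ n)) (L ^ n * (L * z)))"
    by (simp add: mult_2 funpow_add mult.assoc mult.commute[of L])
  also have "\<dots> = (- L) ^ n * fhat (fhat (L * z))"
    using X_fhat z by (simp add: f0_funpow_sign)
  finally show ?thesis .
qed

end

lemma X_extension:
  "X n \<subseteq> What \<and> (\<forall>z\<in>X n. (f0 ^^ (2 ^ n)) (L ^ n * z) = (- L) ^ n * fhat z)"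
proof (induction n)
  case 0
  have "X 0 = W" by (auto simp: X_def Y_def)
  moreover obtain S where "open S" "I \<subseteq> S" "\<And>z. z \<in> S \<Longrightarrow> f0 z = f z"
    using f0_eq_f by metis
  then have "\<forall>\<^sub>F z in nhds 0. f0 z = f z"
    unfolding eventually_nhds using zero_in_I by blast
  ultimately show ?case
    using extend_at_0[OF open_X connected_X _ _ , of f0 0] f0_hol I_subset_X[of 0] zero_in_I by auto
next
  case (Suc n)
  then have IH: "X n \<subseteq> What" "\<And>z. z \<in> X n \<Longrightarrow> (f0 ^^ (2 ^ n)) (L ^ n * z) = (- L) ^ n * fhat z"
    by auto
  \<comment> \<open>The right-hand side of the functional equation, written with
    \<open>fhat\<close>. It agrees with \<open>f\<close> near 0, so maximality identifies it with
    \<open>fhat\<close>.\<close>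
  define h where "h z = - (1 / L) * fhat (fhat (L * z))" for z
  have maps: "L * z \<in> What" "fhat (L * z) \<in> What" if "z \<in> X (Suc n)" for z
    using that X_Suc_iff[OF IH] IH(1) by blast+
  have "fhat \<circ> (fhat \<circ> (\<lambda>z. L * z)) holomorphic_on X (Suc n)"
    using fhat_hol maps by (intro holomorphic_on_compose_gen[where t = What])
      (auto intro!: holomorphic_intros)
  then have "h holomorphic_on X (Suc n)"
    unfolding h_def by (intro holomorphic_intros) (simp add: o_def)
  moreover have "\<forall>\<^sub>F z in nhds 0. h z = f z"
  proof -
    have D: "open D" "0 \<in> D" "1 \<in> D" "0 \<in> f -` D"
      using open_D zero_in_I one_in_I I_subset_D f_0 by auto
    have "open (D \<inter> f -` D)"
      using f_cont open_D open_D by (rule continuous_open_preimage)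
    then have "open ((\<lambda>z. L * z) -` (D \<inter> f -` D))"
      by (rule open_vimage) (intro continuous_intros)
    then have "\<forall>\<^sub>F z in nhds 0. z \<in> (\<lambda>z. L * z) -` (D \<inter> f -` D)"
      by (rule eventually_nhds_in_open) (use D in auto)
    with f_eq show ?thesis
      by eventually_elim (simp add: h_def fhat_eq_f)
  qed
  ultimately have h: "X (Suc n) \<subseteq> What" "\<And>z. z \<in> X (Suc n) \<Longrightarrow> h z = fhat z"
    using extend_at_0[OF open_X connected_X] I_subset_X zero_in_I by blast+
  have "(f0 ^^ (2 ^ Suc n)) (L ^ Suc n * z) = (- L) ^ Suc n * fhat z" if "z \<in> X (Suc n)" for z
    using X_Suc_fhat[OF IH that] h(2)[OF that, symmetric] by (simp add: h_def)
  with h(1) show ?case by blast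
qed

lemmas X_subset_What = X_extension[THEN conjunct1]
lemmas X_fhat_eq = X_extension[THEN conjunct2, rule_format]
lemmas X_Suc = X_Suc_iff[OF X_subset_What X_fhat_eq]

text \<open>
  Along a path in \<open>What\<close> starting at \<open>0\<close> the function \<open>fhat\<close> is bounded, and for large \<open>n\<close> the
  restriction of \<open>fhat\<close> to \<open>X n\<close> is proper over the disc containing its values, so that the
  path cannot leave \<open>X n\<close>.
\<close>

lemma eventually_in_X:
  assumes "z \<in> What"
  shows "\<forall>\<^sub>F n in sequentially. z \<in> X n"
proof -
  have "0 \<in> What" using zero_in_I I_subset_D D_subset_What by blast
  moreover have "path_connected What"
    using open_What connected_What by (simp add: connected_open_path_connected)
  ultimately obtain p where p: "path p" "path_image p \<subseteq> What" "pathstart p = 0" "pathfinish p = z"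
    using assms unfolding path_connected_def by blast
  define P where "P = path_image p"
  have P: "compact P" "connected P" "P \<subseteq> What" "0 \<in> P" "z \<in> P"
    unfolding P_def using p by (auto simp: compact_path_image connected_path_image
        intro: pathstart_in_path_image[of p, unfolded p(3)] pathfinish_in_path_image[of p, unfolded p(4)])
  have "compact (fhat ` P)"
    using P fhat_hol by (intro compact_continuous_image)
      (auto intro: holomorphic_on_imp_continuous_on holomorphic_on_subset)
  then obtain R where R: "\<And>y. y \<in> P \<Longrightarrow> norm (fhat y) \<le> R"
    by (meson bounded_iff compact_imp_bounded imageI)
  have "(\<lambda>n. lam ^ n * R) \<longlonglongrightarrow> 0 * R"
    using lam_pos lam_less_1 by (intro tendsto_intros LIMSEQ_realpow_zero) auto
  then have "\<forall>\<^sub>F n in sequentially. lam ^ n * R < 1"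
    by (auto dest: order_tendstoD(2)[of _ _ _ 1])
  then show ?thesis
  proof eventually_elim
    case (elim n)
    \<comment> \<open>The factor \<open>(- L) ^ n\<close> turns the bound \<open>R\<close> on
      \<open>fhat\<close> into this radius; being below 1, it keeps the disc off both slits.\<close>
    define K :: "complex set" where "K = cball 0 (lam ^ n * R)"
    have "compact K" by (simp add: K_def)
    have "K \<subseteq> slit_plane lam"
    proof
      fix v assume "v \<in> K"
      then have "norm v < 1" using elim by (simp add: K_def)
      then have "\<bar>Re v\<bar> < 1" using abs_Re_le_cmod[of v] by linarith
      then show "v \<in> slit_plane lam"
        using one_less_inverse_lam by (auto simp: slit_plane_iff)
    qed
    \<comment> \<open>Compact by properness. Within \<open>X n\<close> it is cut out by
      \<open>norm (fhat y) \<le> R\<close>, which makes \<open>P \<inter> X n\<close> clopen in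
      \<open>P\<close>.\<close>
    define Q where "Q = {y. L ^ n * y \<in> {w \<in> Y (2 ^ n). (f0 ^^ (2 ^ n)) w \<in> K}}"
    have "compact Q"
      unfolding Q_def X_image using compact_Y_preimage[OF \<open>compact K\<close> \<open>K \<subseteq> slit_plane lam\<close>]
      by (intro compact_continuous_image continuous_intros) auto
    have "y \<in> Q \<longleftrightarrow> y \<in> X n \<and> norm (fhat y) \<le> R" for y
    proof (cases "y \<in> X n")
      case True
      then show ?thesis
        using X_fhat_eq[OF True] lam_pos
        by (simp add: Q_def K_def X_def norm_mult norm_power)
    qed (simp add: Q_def X_def)
    then have "P \<inter> X n = P \<inter> Q" using R by blast
    moreover have "closedin (top_of_set P) (P \<inter> Q)"
      using \<open>compact Q\<close> by (intro closedin_closed_Int compact_imp_closed)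
    moreover have "openin (top_of_set P) (P \<inter> X n)"
      using open_X by (intro openin_open_Int)
    moreover have "0 \<in> P \<inter> X n"
      using P(4) I_subset_X zero_in_I by blast
    ultimately have "P \<inter> X n = P"
      using P(2) unfolding connected_clopen by (metis empty_iff)
    then show "z \<in> X n" using P(5) by blast
  qed
qed

section \<open>Functional equation and symmetry on \<open>What\<close>\<close>

lemma obtain_X:
  assumes "z \<in> What" obtains n where "z \<in> X (Suc n)"
  using eventually_in_X[OF assms] unfolding eventually_sequentially by (meson le_SucI order_refl)

lemma What_iff: "z \<in> What \<longleftrightarrow> L * z \<in> What \<and> fhat (L * z) \<in> What"
proof
  assume "z \<in> What"
  then obtain n where "z \<in> X (Suc n)" by (rule obtain_X)
  then show "L * z \<in> What \<and> fhat (L * z) \<in> What"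
    using X_Suc X_subset_What by blast
next
  assume "L * z \<in> What \<and> fhat (L * z) \<in> What"
  \<comment> \<open>Membership for all large \<open>n\<close> provides an index common to both
    points.\<close>
  then have "\<forall>\<^sub>F n in sequentially. L * z \<in> X n \<and> fhat (L * z) \<in> X n"
    using eventually_in_X by (simp add: eventually_conj)
  then obtain n where "L * z \<in> X n" "fhat (L * z) \<in> X n"
    unfolding eventually_sequentially by blast
  then show "z \<in> What" using X_Suc X_subset_What by blast
qed

text \<open>Compare two expressions for the iterate of order \<open>2 ^ Suc n\<close> and cancel
  \<open>(- L) ^ n\<close>.\<close>

lemma fhat_fhat: "z \<in> What \<Longrightarrow> fhat (fhat (L * z)) = - L * fhat z"
proof -
  assume "z \<in> What"
  then obtain n where z: "z \<in> X (Suc n)" by (rule obtain_X)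
  then have "(- L) ^ n * fhat (fhat (L * z)) = (- L) ^ Suc n * fhat z"
    using X_Suc_fhat[OF X_subset_What X_fhat_eq] X_fhat_eq by metis
  then have "(- L) ^ n * fhat (fhat (L * z)) = (- L) ^ n * (- L * fhat z)"
    by (simp add: mult_ac)
  then show ?thesis unfolding mult_cancel_left by simp
qed

lemma What_minus: "- z \<in> What \<longleftrightarrow> z \<in> What"
  using obtain_X X_minus X_subset_What by (metis add.inverse_inverse subsetD)

lemma fhat_minus: "z \<in> What \<Longrightarrow> fhat (- z) = fhat z"
proof -
  assume "z \<in> What"
  then obtain n where "z \<in> X (Suc n)" by (rule obtain_X)
  then have "(- L) ^ Suc n * fhat (- z) = (- L) ^ Suc n * fhat z"
    using X_fhat_eq[of z "Suc n"] X_fhat_eq[of "- z" "Suc n"]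
      f0_funpow_minus[of "2 ^ Suc n" "L ^ Suc n * z"] by (simp add: X_minus)
  then show ?thesis unfolding mult_cancel_left by simp
qed

section \<open>Orbits under \<open>fhat\<close> and the intersection\<close>

lemma fhat_funpow_minus:
  assumes "z \<in> What" shows "(fhat ^^ k) (- z) = (if k = 0 then - z else (fhat ^^ k) z)"
  using assms by (cases k) (auto simp: fhat_minus funpow_Suc_right simp del: funpow.simps(2))

text \<open>The orbit splits into two halves: the claim for \<open>L * y\<close> covers the first
  and ends at \<open>(- L) ^ n * w\<close>; up to sign, the claim for \<open>w\<close> covers the
  second.\<close>

lemma fhat_funpow_scaled:
  assumes "y \<in> What"
  shows "(\<forall>k<2 ^ n. (fhat ^^ k) (L ^ n * y) \<in> What) \<and> (fhat ^^ (2 ^ n)) (L ^ n * y) = (- L) ^ n * fhat y"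
  using assms
proof (induction n arbitrary: y)
  case 0
  then show ?case by simp
next
  case (Suc n)
  define w where "w = fhat (L * y)"
  have "L * y \<in> What" "w \<in> What" using Suc.prems What_iff[of y] by (auto simp: w_def)
  note 1 = Suc.IH[OF \<open>L * y \<in> What\<close>, folded w_def] and 2 = Suc.IH[OF \<open>w \<in> What\<close>]
  have w: "L ^ n * w \<in> What" using 2 by (auto dest: spec[of _ 0])
  \<comment> \<open>At \<open>k = 0\<close> the sign survives, and membership follows from the
    symmetry of \<open>What\<close> instead.\<close>
  have sign: "(fhat ^^ k) ((- L) ^ n * w) \<in> What \<longleftrightarrow> (fhat ^^ k) (L ^ n * w) \<in> What"
    "k > 0 \<Longrightarrow> (fhat ^^ k) ((- L) ^ n * w) = (fhat ^^ k) (L ^ n * w)" for k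
    using minus_L_power[of n w] fhat_funpow_minus[OF w, of k] What_minus[of "L ^ n * w"]
    by (auto split: if_splits)
  have split: "(fhat ^^ (k + 2 ^ n)) (L ^ Suc n * y) = (fhat ^^ k) ((- L) ^ n * w)" for k
    using 1 by (simp add: funpow_add mult.assoc mult.commute[of L])
  have "(fhat ^^ k) (L ^ Suc n * y) \<in> What" if "k < 2 ^ Suc n" for k
  proof (cases "k < 2 ^ n")
    case True
    then show ?thesis using 1 by (simp add: mult.assoc mult.commute[of L])
  next
    case False
    then show ?thesis
      using split[of "k - 2 ^ n"] sign(1)[of "k - 2 ^ n"] 2 that by simp
  qed
  moreover have "(fhat ^^ (2 ^ Suc n)) (L ^ Suc n * y) = (- L) ^ Suc n * fhat y"
    using split[of "2 ^ n"] sign(2)[of "2 ^ n"] 2 fhat_fhat[OF Suc.prems]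
    by (simp add: mult_2 w_def)
  ultimately show ?case by blast
qed

text \<open>Since \<open>fhat (fhat (L * y)) = - L * fhat y\<close>, one step from
  \<open>z / L\<close> corresponds, up to sign, to two steps from \<open>z\<close>. By
  \<open>What_iff\<close>, every orbit point of \<open>z\<close> divided by \<open>L\<close> lies in
  \<open>What\<close>.\<close>

lemma nonescaping_scale:
  assumes "z \<in> nonescaping_set fhat What"
  shows "z / L \<in> nonescaping_set fhat What"
proof -
  have in_What: "(fhat ^^ k) z \<in> What" for k
    using assms by (simp add: nonescaping_set_def)
  have scaled: "(fhat ^^ k) z / L \<in> What" for k
    using in_What[of k] in_What[of "Suc k"] What_iff[of "(fhat ^^ k) z / L"] by simp
  have "(fhat ^^ k) (z / L) \<in> {(fhat ^^ (2 * k)) z / L, - ((fhat ^^ (2 * k)) z / L)}" for k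
  proof (induction k)
    case (Suc k)
    then have "fhat ((fhat ^^ k) (z / L)) = fhat ((fhat ^^ (2 * k)) z / L)"
      using fhat_minus[OF scaled] by auto
    also have "\<dots> = - ((fhat ^^ (2 * Suc k)) z / L)"
      using fhat_fhat[OF scaled[of "2 * k"]] by (simp add: field_simps)
    finally show ?case by simp
  qed simp
  then have "(fhat ^^ k) (z / L) \<in> What" for k
    using scaled What_minus by (metis empty_iff insert_iff)
  then show ?thesis
    unfolding nonescaping_set_def using scaled[of 0] by simp
qed

theorem Inter_scaled_What:
  "(\<Inter>n::nat. (\<lambda>z. of_real (lam ^ n) * z) ` What) = nonescaping_set fhat What"
proof (intro equalityI subsetI)
  fix z assume z: "z \<in> (\<Inter>n::nat. (\<lambda>z. of_real (lam ^ n) * z) ` What)"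
  have "(fhat ^^ k) z \<in> What" for k
  proof -
    \<comment> \<open>Scaling by \<open>L ^ k\<close> controls the first \<open>2 ^ k\<close>
      iterates, and \<open>k < 2 ^ k\<close>.\<close>
    obtain y where "y \<in> What" "z = L ^ k * y" using z by auto
    then show ?thesis using fhat_funpow_scaled[of y k] less_exp[of k] by blast
  qed
  from this and this[of 0] show "z \<in> nonescaping_set fhat What"
    by (simp add: nonescaping_set_def)
next
  fix z assume "z \<in> nonescaping_set fhat What"
  then have "z / L ^ n \<in> nonescaping_set fhat What" for n
  proof (induction n)
    case (Suc n)
    then show ?case using nonescaping_scale[of "z / L ^ n"] by (simp add: mult.commute)
  qed simp
  then have "of_real (lam ^ n) * (z / L ^ n) \<in> (\<lambda>z. of_real (lam ^ n) * z) ` What" for n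
    by (intro imageI) (simp add: nonescaping_set_def)
  then show "z \<in> (\<Inter>n::nat. (\<lambda>z. of_real (lam ^ n) * z) ` What)"
    by simp
qed

end

section \<open>Passage from the original hypotheses to the locale\<close>

theorem theorem3:
  fixes l :: nat and lam :: real
    and f fhat :: "complex \<Rightarrow> complex" and D What :: "complex set"
  assumes l: "even l" "l \<ge> 2"
    and f_domain: "open D" "connected D" "of_real ` {-1..1::real} \<subseteq> D"
    and f_holomorphic: "f holomorphic_on D"
    and f_real: "\<And>x::real. x \<in> {-1..1} \<Longrightarrow> f (of_real x) \<in> \<real>"
    and f_fixed_point: "pd_fixed_point (\<lambda>x. Re (f (of_real x)))"
    and lam: "of_real lam = - f (f 0)" "0 < lam" "lam < 1"
    and f_equation: "\<forall>\<^sub>F z in nhds 0. f z = - (1 / of_real lam) * f (f (of_real lam * z))"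
    and f_0: "f 0 = 1"
    and f_form: "univalent_inverse_form l lam f"
    and fhat: "maximal_analytic_extension f D fhat What"
    and What: "simply_connected What"
  shows "(\<Inter>n::nat. (\<lambda>z. of_real (lam ^ n) * z) ` What) = nonescaping_set fhat What"
proof -
  obtain F G where F: "F analytic_on {0}" "\<forall>\<^sub>F z in nhds 0. f z = F (z ^ l)"
    and G: "G holomorphic_on slit_plane lam" "inj_on G (slit_plane lam)" "\<forall>\<^sub>F w in nhds 0. G (F w) = w"
    using f_form unfolding univalent_inverse_form_def by blast
  \<comment> \<open>As \<open>z ^ l\<close> tends to 0 with \<open>z\<close>, the inverse identity
    may be evaluated at \<open>w = z ^ l\<close>.\<close>
  have "((\<lambda>z::complex. z ^ l) \<longlongrightarrow> 0 ^ l) (nhds 0)"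
    by (intro tendsto_intros filterlim_ident)
  then have "filterlim (\<lambda>z::complex. z ^ l) (nhds 0) (nhds 0)"
    using l by (simp add: zero_power)
  then have "\<forall>\<^sub>F z in nhds 0. G (F (z ^ l)) = z ^ l"
    using G(3) by (rule eventually_compose_filterlim[rotated])
  with F(2) have G_f: "\<forall>\<^sub>F z in nhds 0. G (f z) = z ^ l"
    by eventually_elim simp
  \<comment> \<open>Unimodality bounds the real part, and \<open>f\<close> is real on [-1, 1];
    together they give invariance of the interval.\<close>
  have "unimodal (\<lambda>x. Re (f (of_real x)))"
    using f_fixed_point by (simp add: pd_fixed_point_def pd_renormalizable_def)
  then have "Re (f (of_real x)) \<in> {-1..1}" if "x \<in> {-1..1}" for x
    using that unfolding unimodal_def by blast
  then have "f (of_real x) \<in> of_real ` {-1..1}" if "x \<in> {-1..1}" for x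
    using that f_real[OF that] by (metis image_eqI of_real_Re)
  then have f_interval: "f ` of_real ` {-1..1} \<subseteq> of_real ` {-1..1}"
    by blast
  have "f 1 = - of_real lam" using lam(1) f_0 by simp
  then interpret feigenbaum l lam f fhat G D What
    using assms G G_f f_interval by unfold_locales auto
  show ?thesis by (rule Inter_scaled_What)
qed

end
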